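(* Let $k^*,h^*\ge 1$, and let $\boldsymbol{\epsilon}=(\alpha,\beta)$ with $0\le\alpha\le 1$ and $0\le\beta<\frac1{24}$. Any weakly $(\boldsymbol{\epsilon},\frac34)$-feasible fully dynamic algorithm with pruning thresholds $k^*,h^*$ uses space $$\Omega\Big(\frac{n\cdot d}{k^*\cdot\log n}\Big),$$ where $d$ is the number of features and $n$ is the maximum size of the active set at any point in time.
   Context: **Examples and Gini gain.** Examples have $d$ features (feature domain $\mathcal{X}$, which may be $\mathbb{R}^d$ or $\{0,1\}^d$) and labels in $\{0,1\}$. $S$ denotes a finite multiset of labeled examples $(x,y)\in\mathcal{X}\times\{0,1\}$; $x_j$ is the $j$-th feature of $x$; $[d]=\{1,\dots,d\}$. $S[x_j\le t]=\{(x,y)\in S: x_j\le t\}$ (as a sub-multiset), and similarly for $S[x_j>t]$. A split is a pair $(j,t)\in[d]\times\mathbb{R}$. The Gini index of $S$ is $g(S)=2p_S(1-p_S)$ with $p_S=\frac1{|S|}\sum_{(x,y)\in S}y$. The Gini gain of $(j,t)$ on $S$ is $G(S,j,t)=g(S)-\big(\frac{|S_-|}{|S|}g(S_-)+\frac{|S_+|}{|S|}g(S_+)\big)$ where $S_-=S[x_j\le t]$, $S_+=S[x_j>t]$. If $|S|=0$ then $g(S)=0$ and $G(S,j,t)=0$. **Decision trees.** A decision tree is a triple $(T,\Sigma,L)$ where $T$ is a rooted directed binary tree with vertex set $V(T)$, $\Sigma$ assigns a split $\sigma_v=(j_v,t_v)$ to each internal node $v$, and $L$ assigns a label $L_v\in\{0,1\}$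 to each leaf. An $x\in\mathcal{X}$ arriving at internal node $v$ goes to the left child if $x_{j_v}\le t_v$ and to the right child otherwise. $S_v$ denotes the sub-multiset of $S$ of those examples whose root-to-leaf route passes through $v$. $T(x)$ is the label of the leaf reached by $x$. The root has depth $0$. **Feasibility.** $(T,\Sigma,L)$ is $(\alpha,\beta)$-feasible with pruning thresholds $(k,h)$ w.r.t. $S$ if for every $v\in V(T)$: (1) if $|S_v|\le k$ or $g(S_v)=0$ or $\mathrm{depth}_T(v)=h$ then $v$ is a leaf, else if $g(S_v)\ge\alpha$ then $v$ is an internal node; (2) if $\sigma_v=(j,a)$ then $G(S_v,j,a)\ge G(S_v,j',a')-\beta$ for all $(j',a')\in[d]\times\mathbb{R}$; (3) if $v$ is a leaf then $L_v$ is a majority label of $S_v$. **Fully dynamic algorithms and weak feasibility.** A fully dynamic decision tree algorithm $\mathcal{A}$ (possibly randomized) receives an arbitrary sequence of requests of three types: insertion $\mathrm{ins}(x,y)$, deletion $\mathrm{del}(x,y)$, labeling $\mathrm{lab}(x)$. The sequence induces an active multiset $S$, obtained by performing the insertions and deletions in order; $\mathcal{A}_S(x)$ denotes the answer of $\mathcal{A}$ to $\mathrm{lab}(x)$ when the active multiset is $S$. $\mathcal{A}$ is weakly $(\boldsymbol{\epsilon},\delta)$-feasible w.r.t. $S$ if for every $x\in\mathcal{X}$ there is a decision tree $(T_x,\Sigma_x,L_x)$ that is $\boldsymbol{\epsilon}$-feasible w.r.t. $S$ (for the given pruning thresholds) and such that $\Pr(\mathcal{A}_S(x)=T_x(x))\ge\delta$.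 The fully dynamic algorithm is weakly $(\boldsymbol{\epsilon},\delta)$-feasible if this holds at every point in time w.r.t. the current active multiset, for every request sequence fixed in advance (oblivious adversary). Space is the number of bits of memory used.
   Formalization: For the feature domain {0,1}^d the bound is proved only when n ≤ k*·2^d (otherwise it is false, e.g. d = k* = 1, where counters suffice); request sequences may delete inactive examples, with no effect. *)

theory Defs
  imports "HOL-Probability.Probability_Mass_Function" "HOL-Library.Multiset"
begin

section \<open>Examples and Gini gain\<close>

text \<open>
  A feature vector is an extensional function on \<open>{1..d}\<close>; the dimension is a term rather than a
  type because the constant hidden in the asymptotic bound must not depend on it.
  \<open>True\<close> and \<open>False\<close> are the labels 1 and 0.
\<close>

type_synonym point = "nat \<Rightarrow> real"
type_synonym sample = "(point \<times> bool) multiset"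

definition real_domain :: "nat \<Rightarrow> point set" where
  "real_domain d = ({1..d} \<rightarrow>\<^sub>E UNIV)"

definition boolean_domain :: "nat \<Rightarrow> point set" where
  "boolean_domain d = ({1..d} \<rightarrow>\<^sub>E {0, 1})"

definition le_part :: "sample \<Rightarrow> nat \<Rightarrow> real \<Rightarrow> sample" where
  "le_part S j t = {#e \<in># S. fst e j \<le> t#}"

definition gt_part :: "sample \<Rightarrow> nat \<Rightarrow> real \<Rightarrow> sample" where
  "gt_part S j t = {#e \<in># S. fst e j > t#}"

definition pos_fraction :: "sample \<Rightarrow> real" where
  "pos_fraction S = (\<Sum>(x, y)\<in>#S. of_bool y) / real (size S)"

text \<open>Since \<open>x / 0 = 0\<close>, both the index and the gain are 0 on the empty sample, as they should be.\<close>

definition gini :: "sample \<Rightarrow> real" where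
  "gini S = 2 * pos_fraction S * (1 - pos_fraction S)"

definition gini_gain :: "sample \<Rightarrow> nat \<Rightarrow> real \<Rightarrow> real" where
  "gini_gain S j t =
     gini S - (real (size (le_part S j t)) / real (size S) * gini (le_part S j t)
             + real (size (gt_part S j t)) / real (size S) * gini (gt_part S j t))"

definition majority_label :: "sample \<Rightarrow> bool \<Rightarrow> bool" where
  "majority_label S c \<longleftrightarrow> size {#e \<in># S. snd e \<noteq> c#} \<le> size {#e \<in># S. snd e = c#}"


section \<open>Decision trees\<close>

datatype dtree = Leaf bool | Node nat real dtree dtree

fun classify :: "dtree \<Rightarrow> point \<Rightarrow> bool" where
  "classify (Leaf c) x = c"
| "classify (Node j t l r) x = (if x j \<le> t then classify l x else classify r x)"

text \<open>
  The vertices \<open>v\<close> of a tree whose root has depth \<open>m\<close> and receives the sample \<open>S\<close>; each is given as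
  the triple of its depth, the sample \<open>S\<^sub>v\<close> routed through it, and the subtree rooted at it.
\<close>

fun vertices :: "nat \<Rightarrow> sample \<Rightarrow> dtree \<Rightarrow> (nat \<times> sample \<times> dtree) set" where
  "vertices m S (Leaf c) = {(m, S, Leaf c)}"
| "vertices m S (Node j t l r) =
     insert (m, S, Node j t l r)
       (vertices (Suc m) (le_part S j t) l \<union> vertices (Suc m) (gt_part S j t) r)"

definition is_leaf :: "dtree \<Rightarrow> bool" where
  "is_leaf v \<longleftrightarrow> (\<exists>c. v = Leaf c)"

definition feasible ::
    "nat \<Rightarrow> nat \<Rightarrow> nat \<Rightarrow> real \<Rightarrow> real \<Rightarrow> sample \<Rightarrow> dtree \<Rightarrow> bool" where
  "feasible d k h \<alpha> \<beta> S T \<longleftrightarrow>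
     (\<forall>(m, Sv, v) \<in> vertices 0 S T.
        (if size Sv \<le> k \<or> gini Sv = 0 \<or> m = h then is_leaf v
         else gini Sv \<ge> \<alpha> \<longrightarrow> \<not> is_leaf v) \<and>
        (\<forall>j a l r. v = Node j a l r \<longrightarrow>
           j \<in> {1..d} \<and>
           (\<forall>j' \<in> {1..d}. \<forall>a'. gini_gain Sv j a \<ge> gini_gain Sv j' a' - \<beta>)) \<and>
        (\<forall>c. v = Leaf c \<longrightarrow> majority_label Sv c))"


section \<open>Fully dynamic algorithms\<close>

datatype request = Ins point bool | Del point bool | Lab point

fun req_point :: "request \<Rightarrow> point" where
  "req_point (Ins x y) = x"
| "req_point (Del x y) = x"
| "req_point (Lab x) = x"

text \<open>
  Request sequences are arbitrary, so a deletion may name an example that is not active; as usual for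
  multiset difference, it then has no effect.
\<close>

fun perform :: "request \<Rightarrow> sample \<Rightarrow> sample" where
  "perform (Ins x y) S = add_mset (x, y) S"
| "perform (Del x y) S = S - {#(x, y)#}"
| "perform (Lab x) S = S"

definition active :: "request list \<Rightarrow> sample" where
  "active rs = fold perform rs {#}"

definition requests_over :: "point set \<Rightarrow> request list \<Rightarrow> bool" where
  "requests_over X rs \<longleftrightarrow> (\<forall>r \<in> set rs. req_point r \<in> X)"

text \<open>
  The memory kept between requests is an unbounded tape of bits, so that unbounded (even over the
  reals) algorithms exist and space is a measured quantity. The algorithm uses fresh
  random bits at every request; whatever it wants to reuse later, it has to store. A labeling request
  returns an answer, and may modify the memory as well.
\<close>

type_synonym memory = "nat \<Rightarrow> bool"

datatype algorithm = Algorithm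
  (init_mem: "memory pmf")
  (on_ins: "point \<Rightarrow> bool \<Rightarrow> memory \<Rightarrow> memory pmf")
  (on_del: "point \<Rightarrow> bool \<Rightarrow> memory \<Rightarrow> memory pmf")
  (on_lab: "point \<Rightarrow> memory \<Rightarrow> (bool \<times> memory) pmf")

fun next_mem :: "algorithm \<Rightarrow> request \<Rightarrow> memory \<Rightarrow> memory pmf" where
  "next_mem A (Ins x y) m = on_ins A x y m"
| "next_mem A (Del x y) m = on_del A x y m"
| "next_mem A (Lab x) m = map_pmf snd (on_lab A x m)"

definition run :: "algorithm \<Rightarrow> request list \<Rightarrow> memory pmf" where
  "run A rs = fold (\<lambda>r M. bind_pmf M (next_mem A r)) rs (init_mem A)"

definition answer :: "algorithm \<Rightarrow> request list \<Rightarrow> point \<Rightarrow> bool pmf" where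
  "answer A rs x = bind_pmf (run A rs) (\<lambda>m. map_pmf fst (on_lab A x m))"

text \<open>Quantifying over all finite sequences includes all prefixes, hence every point in time.\<close>

definition weakly_feasible ::
    "nat \<Rightarrow> point set \<Rightarrow> nat \<Rightarrow> nat \<Rightarrow> real \<Rightarrow> real \<Rightarrow> real \<Rightarrow> algorithm \<Rightarrow> bool" where
  "weakly_feasible d X k h \<alpha> \<beta> \<delta> A \<longleftrightarrow>
     (\<forall>rs. requests_over X rs \<longrightarrow>
        (\<forall>x \<in> X. \<exists>T. feasible d k h \<alpha> \<beta> (active rs) T \<and>
           measure_pmf.prob (answer A rs x) {classify T x} \<ge> \<delta>))"

text \<open>
  \<open>A\<close> works within \<open>b\<close> bits on the request sequences whose active multiset never exceeds size \<open>n\<close>: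
  the memory cells from address \<open>b\<close> on stay blank.
\<close>

definition space_at_most :: "algorithm \<Rightarrow> point set \<Rightarrow> nat \<Rightarrow> nat \<Rightarrow> bool" where
  "space_at_most A X n b \<longleftrightarrow>
     (\<forall>rs. requests_over X rs \<and> (\<forall>i \<le> length rs. size (active (take i rs)) \<le> n) \<longrightarrow>
        (\<forall>m \<in> set_pmf (run A rs). \<forall>i \<ge> b. \<not> m i))"

end

theory Submission imports Defs begin

text \<open>
  Deleting an inactive example has no effect, so the algorithm can be asked to delete all examples of
  an arbitrary set \<open>D\<close> after it has stored a secret set \<open>F\<close>, and then all but one point \<open>u\<close>; the
  majority label at \<open>u\<close> tells whether \<open>u \<in> F - D\<close>. A fixed memory state from which these tests
  succeed, on average over \<open>D\<close>, for the points of a set \<open>A\<close> must afterwards encode \<open>D \<inter> A\<close>, whence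
  \<open>b = \<Omega>(card A)\<close>. So each of the \<open>2 ^ b\<close> memory states determines a list of \<open>O(b)\<close> points, and
  for every \<open>F\<close> some list contains a third of \<open>F\<close>. If the universe is much larger than \<open>b\<close>, a
  random \<open>F\<close> of order \<open>n\<close> points meets a given list so often only with probability
  \<open>2 ^ (- \<Omega>(n d))\<close>, which forces \<open>b = \<Omega>(n d)\<close>. If \<open>d = O(ln n)\<close>, it suffices that a list contains
  a third of a fixed \<open>F\<close>. On the real domain the universe is arbitrarily large, and no finite \<open>b\<close> works.
\<close>

section \<open>Random codes with few memory states\<close>

text \<open>
  \<open>p D\<close> is the distribution of the final state when the set \<open>D\<close> is encoded, and \<open>t q\<close> the
  probability that the test for \<open>u\<close> declares \<open>u\<close> absent from \<open>D\<close> in state \<open>q\<close>.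
\<close>

definition correlation ::
    "'a set \<Rightarrow> 'q set \<Rightarrow> ('a set \<Rightarrow> 'q \<Rightarrow> real) \<Rightarrow> ('q \<Rightarrow> real) \<Rightarrow> 'a \<Rightarrow> real" where
  "correlation U Q p t u =
     (\<Sum>D\<in>Pow U. (if u \<in> D then -1 else 1) * (\<Sum>q\<in>Q. p D q * (2 * t q - 1))) / 2 ^ card U"

text \<open>Sub-Gaussian bound for the moment generating function of a random sign. The exponent
  \<open>x^2\<close>, in place of the sharp \<open>x^2 / 2\<close>, follows already from quadratic
  bounds on \<open>exp\<close> over [0, 1].\<close>

lemma cosh_le_exp_square:
  fixes x :: real
  assumes "\<bar>x\<bar> \<le> 1"
  shows "exp x + exp (- x) \<le> 2 * exp (x\<^sup>2)"
proof -
  have *: "exp y + exp (- y) \<le> 2 * exp (y\<^sup>2)" if "0 \<le> y" "y \<le> 1" for y :: real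
  proof -
    have 1: "exp y \<le> 1 + y + y\<^sup>2"
      using exp_bound that by blast
    have "1 \<le> (1 - y + y\<^sup>2) * (1 + y)"
      using that by (simp add: algebra_simps power2_eq_square)
    also have "\<dots> \<le> (1 - y + y\<^sup>2) * exp y"
      using that by (intro mult_left_mono exp_ge_add_one_self_aux) auto
    finally have "exp (- y) \<le> 1 - y + y\<^sup>2"
      by (simp add: exp_minus field_simps)
    with 1 have "exp y + exp (- y) \<le> 2 * (1 + y\<^sup>2)" by simp
    also have "\<dots> \<le> 2 * exp (y\<^sup>2)"
      by (intro mult_left_mono exp_ge_add_one_self) simp
    finally show ?thesis .
  qed
  show ?thesis
    using *[of x] *[of "- x"] assms by (cases "0 \<le> x") auto
qed

text \<open>
  A random code for subsets of \<open>A\<close> with \<open>card Q\<close> states needs \<open>ln (card Q)\<close> proportional to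
  \<open>card A\<close>: compare the exponential moment of the total agreement \<open>y\<close>, bounded below by Jensen's
  inequality, with the union bound over the final states.
\<close>

lemma card_correlated_le:
  fixes p :: "'a set \<Rightarrow> 'q \<Rightarrow> real" and t :: "'a \<Rightarrow> 'q \<Rightarrow> real"
  assumes U: "finite U" and Q: "finite Q" "Q \<noteq> {}" and A: "A \<subseteq> U"
    and p_nonneg: "\<And>D q. D \<subseteq> U \<Longrightarrow> q \<in> Q \<Longrightarrow> 0 \<le> p D q"
    and p_sum: "\<And>D. D \<subseteq> U \<Longrightarrow> (\<Sum>q\<in>Q. p D q) = 1"
    and t: "\<And>u q. 0 \<le> t u q \<and> t u q \<le> 1"
    and corr: "\<And>u. u \<in> A \<Longrightarrow> 1 / 4 \<le> correlation U Q p (t u) u"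
  shows "real (card A) \<le> 64 * ln (card Q)"
proof -
  have finA: "finite A" using A U finite_subset by blast
  define s :: "'a set \<Rightarrow> 'a \<Rightarrow> real" where "s D u = (if u \<in> D then -1 else 1)" for D u
  define g where "g u q = 2 * t u q - 1" for u q
  have g: "\<bar>g u q\<bar> \<le> 1" for u q
    using t[of u q] by (auto simp: g_def)
  \<comment> \<open>The scale c = 1/8 maximizes c/4 - c^2: correlation 1/4 per point gives the
    scaled agreement a mean of at least card A / 32 = \<open>a\<close>, while the second-order cost
    is card A / 64 = \<open>a / 2\<close>.\<close>
  define y where "y D q = (\<Sum>u\<in>A. s D u * g u q) / 8" for D q
  have y8: "8 * y D q = (\<Sum>u\<in>A. s D u * g u q)" for D q
    by (simp add: y_def)
  define a where "a = real (card A) / 32"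
  have p_le: "p D q \<le> 1" if "D \<subseteq> U" "q \<in> Q" for D q
    using member_le_sum[of q Q "p D"] that p_nonneg p_sum Q by auto
  have low: "exp a * 2 ^ card U \<le> (\<Sum>D\<in>Pow U. \<Sum>q\<in>Q. p D q * exp (y D q))"
  proof -
    have "2 ^ card U / 4 \<le> (\<Sum>D\<in>Pow U. s D u * (\<Sum>q\<in>Q. p D q * g u q))" if "u \<in> A" for u
      using corr[OF that] by (simp add: correlation_def s_def g_def field_simps)
    then have "(\<Sum>u\<in>A. 2 ^ card U / 4) \<le> (\<Sum>u\<in>A. \<Sum>D\<in>Pow U. s D u * (\<Sum>q\<in>Q. p D q * g u q))"
      by (intro sum_mono) auto
    also have "\<dots> = (\<Sum>D\<in>Pow U. \<Sum>u\<in>A. s D u * (\<Sum>q\<in>Q. p D q * g u q))"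
      by (rule sum.swap)
    also have "\<dots> = (\<Sum>D\<in>Pow U. \<Sum>q\<in>Q. p D q * (8 * y D q))"
    proof (intro sum.cong refl)
      fix D
      have "(\<Sum>u\<in>A. s D u * (\<Sum>q\<in>Q. p D q * g u q)) = (\<Sum>u\<in>A. \<Sum>q\<in>Q. p D q * (s D u * g u q))"
        by (simp add: sum_distrib_left mult_ac)
      also have "\<dots> = (\<Sum>q\<in>Q. \<Sum>u\<in>A. p D q * (s D u * g u q))"
        by (rule sum.swap)
      finally show "(\<Sum>u\<in>A. s D u * (\<Sum>q\<in>Q. p D q * g u q)) = (\<Sum>q\<in>Q. p D q * (8 * y D q))"
        by (simp add: y8 sum_distrib_left)
    qed
    also have "\<dots> = 8 * (\<Sum>D\<in>Pow U. \<Sum>q\<in>Q. p D q * y D q)"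
      by (simp add: sum_distrib_left mult_ac)
    finally have y: "a * 2 ^ card U \<le> (\<Sum>D\<in>Pow U. \<Sum>q\<in>Q. p D q * y D q)"
      by (simp add: a_def)
    have one: "(\<Sum>D\<in>Pow U. \<Sum>q\<in>Q. p D q) = 2 ^ card U"
      using U p_sum by (simp add: card_Pow)
    have "0 \<le> (\<Sum>D\<in>Pow U. \<Sum>q\<in>Q. p D q * y D q) - a * (\<Sum>D\<in>Pow U. \<Sum>q\<in>Q. p D q)"
      using y unfolding one by simp
    \<comment> \<open>Jensen's inequality through the tangent of \<open>exp\<close> at
      \<open>a\<close>: the bracket is the total of 1 + (y - a), where the weights \<open>p\<close>
      have total mass \<open>2 ^ card U\<close>.\<close>
    then have "exp a * 2 ^ card U \<le> exp a * ((\<Sum>D\<in>Pow U. \<Sum>q\<in>Q. p D q)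
        + ((\<Sum>D\<in>Pow U. \<Sum>q\<in>Q. p D q * y D q) - a * (\<Sum>D\<in>Pow U. \<Sum>q\<in>Q. p D q)))"
      unfolding one by simp
    also have "\<dots> = (\<Sum>D\<in>Pow U. \<Sum>q\<in>Q. p D q * (exp a * (1 + (y D q - a))))"
      by (simp add: algebra_simps sum.distrib sum_subtractf sum_distrib_left)
    also have "\<dots> \<le> (\<Sum>D\<in>Pow U. \<Sum>q\<in>Q. p D q * exp (y D q))"
    proof (intro sum_mono mult_left_mono)
      fix D q
      have "exp a * (1 + (y D q - a)) \<le> exp a * exp (y D q - a)"
        by (intro mult_left_mono) auto
      then show "exp a * (1 + (y D q - a)) \<le> exp (y D q)"
        by (simp add: exp_add[symmetric])
    qed (use p_nonneg in auto)
    finally show ?thesis .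
  qed
  have mgf: "(\<Sum>D\<in>Pow U. exp (y D q)) \<le> 2 ^ card U * exp (a / 2)" for q
  proof -
    \<comment> \<open>The factor 1 outside \<open>A\<close> extends the product to all of
      \<open>U\<close>. Summing over \<open>D\<close> then expands a product of two-term sums, which
      expresses the independence of the signs.\<close>
    define e where "e \<sigma> u = (if u \<in> A then exp (\<sigma> * g u q / 8) else 1)" for \<sigma> :: real and u
    have "exp (y D q) = (\<Prod>u\<in>D. e (-1) u) * (\<Prod>u\<in>U - D. e 1 u)" if "D \<subseteq> U" for D
    proof -
      have "exp (y D q) = (\<Prod>u\<in>A. e (s D u) u)"
        by (simp add: y_def exp_sum finA sum_divide_distrib e_def)
      also have "\<dots> = (\<Prod>u\<in>U. e (s D u) u)"
        using A U by (intro prod.mono_neutral_left) (auto simp: e_def)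
      also have "\<dots> = (\<Prod>u\<in>D. e (s D u) u) * (\<Prod>u\<in>U - D. e (s D u) u)"
        using that U by (metis mult.commute prod.subset_diff)
      finally show ?thesis by (simp add: s_def)
    qed
    then have "(\<Sum>D\<in>Pow U. exp (y D q)) = (\<Prod>u\<in>U. e (-1) u + e 1 u)"
      using U by (subst prod_add) auto
    also have "\<dots> \<le> (\<Prod>u\<in>U. 2 * (if u \<in> A then exp (1 / 64) else 1))"
    proof (intro prod_mono conjI)
      fix u
      have "exp (g u q / 8) + exp (- (g u q / 8)) \<le> 2 * exp ((g u q / 8)\<^sup>2)"
        using g[of u q] by (intro cosh_le_exp_square) auto
      also have "\<dots> \<le> 2 * exp (1 / 64)"
        using g[of u q] by (simp add: power_divide abs_square_le_1)
      finally show "e (-1) u + e 1 u \<le> 2 * (if u \<in> A then exp (1 / 64) else 1)"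
        by (simp add: e_def add.commute)
    qed (auto simp: e_def add_nonneg_nonneg)
    also have "\<dots> = 2 ^ card U * (\<Prod>u\<in>U. if u \<in> A then exp (1 / 64) else 1)"
      by (simp add: prod.distrib)
    also have "(\<Prod>u\<in>U. if u \<in> A then exp (1 / 64) else 1) = (\<Prod>u\<in>A. exp (1 / 64 :: real))"
      using A U by (intro prod.mono_neutral_cong_right) auto
    also have "\<dots> = exp (a / 2)"
      by (simp add: a_def exp_of_nat_mult[symmetric])
    finally show ?thesis .
  qed
  \<comment> \<open>Bounding \<open>p\<close> by 1 removes the dependence of the final state on
    \<open>D\<close>; for each fixed state the signs are independent. The price is the factor
    \<open>card Q\<close>.\<close>
  have "exp a * 2 ^ card U \<le> (\<Sum>D\<in>Pow U. \<Sum>q\<in>Q. 1 * exp (y D q))"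
    using p_le by (intro order.trans[OF low] sum_mono mult_right_mono) auto
  also have "\<dots> = (\<Sum>q\<in>Q. \<Sum>D\<in>Pow U. exp (y D q))"
    by (simp add: sum.swap[of _ Q])
  also have "\<dots> \<le> (\<Sum>q\<in>Q. 2 ^ card U * exp (a / 2))"
    using mgf by (intro sum_mono)
  finally have "exp a \<le> card Q * exp (a / 2)"
    by simp
  moreover have "exp a = exp (a / 2) * exp (a / 2)"
    by (simp add: exp_add[symmetric])
  ultimately have "exp (a / 2) \<le> card Q" by simp
  then have "a / 2 \<le> ln (card Q)"
    using Q by (subst ln_ge_iff) (auto simp: card_gt_0_iff)
  then show ?thesis by (simp add: a_def)
qed

text \<open>A test that is right with probability 3/4 for every \<open>D\<close> has mean
  correlation at least 2 * 3/4 - 1 = 1/2. As correlations never exceed 1, the mass P of states with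
  correlation at least 1/4 satisfies 1/2 \<le> 1/4 + 3/4 * P.\<close>

lemma prob_correlated_ge:
  fixes p :: "'q \<Rightarrow> 'a set \<Rightarrow> 'q \<Rightarrow> real" and t :: "'q \<Rightarrow> real"
  assumes U: "finite U" and Q: "finite Q"
    and \<mu>_nonneg: "\<And>q. q \<in> Q \<Longrightarrow> 0 \<le> \<mu> q" and \<mu>_sum: "(\<Sum>q\<in>Q. \<mu> q) = 1"
    and p_nonneg: "\<And>q D q'. q \<in> Q \<Longrightarrow> D \<subseteq> U \<Longrightarrow> q' \<in> Q \<Longrightarrow> 0 \<le> p q D q'"
    and p_sum: "\<And>q D. q \<in> Q \<Longrightarrow> D \<subseteq> U \<Longrightarrow> (\<Sum>q'\<in>Q. p q D q') = 1"
    and t: "\<And>q. 0 \<le> t q \<and> t q \<le> 1"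
    and test: "\<And>D. D \<subseteq> U \<Longrightarrow>
      (if u \<in> D then (\<Sum>q\<in>Q. \<mu> q * (\<Sum>q'\<in>Q. p q D q' * t q')) \<le> 1 / 4
       else (\<Sum>q\<in>Q. \<mu> q * (\<Sum>q'\<in>Q. p q D q' * t q')) \<ge> 3 / 4)"
  shows "1 / 3 \<le> (\<Sum>q\<in>Q. \<mu> q * of_bool (1 / 4 \<le> correlation U Q (p q) t u))"
proof -
  define s :: "'a set \<Rightarrow> real" where "s D = (if u \<in> D then -1 else 1)" for D
  define E where "E q D = (\<Sum>q'\<in>Q. p q D q' * (2 * t q' - 1))" for q D
  have corr_eq: "correlation U Q (p q) t u = (\<Sum>D\<in>Pow U. s D * E q D) / 2 ^ card U" for q
    by (simp add: correlation_def s_def E_def)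
  have E_eq: "E q D = 2 * (\<Sum>q'\<in>Q. p q D q' * t q') - 1" if "q \<in> Q" "D \<subseteq> U" for q D
    using p_sum[OF that] by (simp add: E_def algebra_simps sum_subtractf sum_distrib_left)
  have le_1: "correlation U Q (p q) t u \<le> 1" if q: "q \<in> Q" for q
  proof -
    have "s D * E q D \<le> 1" if D: "D \<subseteq> U" for D
    proof -
      have "0 \<le> (\<Sum>q'\<in>Q. p q D q' * t q')"
        using q D p_nonneg t by (intro sum_nonneg mult_nonneg_nonneg) auto
      moreover have "(\<Sum>q'\<in>Q. p q D q' * t q') \<le> (\<Sum>q'\<in>Q. p q D q' * 1)"
        using q D p_nonneg t by (intro sum_mono mult_left_mono) auto
      ultimately show ?thesis
        using E_eq[OF q D] p_sum[OF q D] by (auto simp: s_def)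
    qed
    then have "(\<Sum>D\<in>Pow U. s D * E q D) \<le> (\<Sum>D\<in>Pow U. 1)"
      by (intro sum_mono) auto
    then show ?thesis
      using U by (simp add: corr_eq card_Pow)
  qed
  have "(\<Sum>D\<in>Pow U. 1 / 2) \<le> (\<Sum>D\<in>Pow U. s D * (\<Sum>q\<in>Q. \<mu> q * E q D))"
  proof (intro sum_mono)
    fix D assume "D \<in> Pow U"
    then have D: "D \<subseteq> U" by auto
    have "(\<Sum>q\<in>Q. \<mu> q * E q D) = (\<Sum>q\<in>Q. \<mu> q * (2 * (\<Sum>q'\<in>Q. p q D q' * t q') - 1))"
      using E_eq D by (intro sum.cong) auto
    also have "\<dots> = 2 * (\<Sum>q\<in>Q. \<mu> q * (\<Sum>q'\<in>Q. p q D q' * t q')) - 1"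
      using \<mu>_sum by (simp add: algebra_simps sum_subtractf sum_distrib_left)
    finally show "1 / 2 \<le> s D * (\<Sum>q\<in>Q. \<mu> q * E q D)"
      using test[OF D] by (auto simp: s_def split: if_splits)
  qed
  also have "\<dots> = (\<Sum>D\<in>Pow U. \<Sum>q\<in>Q. \<mu> q * (s D * E q D))"
    by (simp add: sum_distrib_left mult_ac)
  also have "\<dots> = (\<Sum>q\<in>Q. \<mu> q * (\<Sum>D\<in>Pow U. s D * E q D))"
    by (subst sum.swap) (simp add: sum_distrib_left)
  also have "\<dots> = 2 ^ card U * (\<Sum>q\<in>Q. \<mu> q * correlation U Q (p q) t u)"
    by (simp add: corr_eq sum_distrib_left sum_divide_distrib)
  finally have "1 / 2 \<le> (\<Sum>q\<in>Q. \<mu> q * correlation U Q (p q) t u)"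
    using U by (simp add: card_Pow)
  also have "\<dots> \<le> (\<Sum>q\<in>Q. \<mu> q * (1 / 4 + 3 / 4 * of_bool (1 / 4 \<le> correlation U Q (p q) t u)))"
    using \<mu>_nonneg le_1 by (intro sum_mono mult_left_mono) auto
  also have "\<dots> = 1 / 4 + 3 / 4 * (\<Sum>q\<in>Q. \<mu> q * of_bool (1 / 4 \<le> correlation U Q (p q) t u))"
    using \<mu>_sum by (simp add: distrib_left sum.distrib sum_distrib_left mult_ac
        flip: sum_divide_distrib)
  finally show ?thesis by simp
qed

section \<open>Samples that meet a small set often\<close>

text \<open>Markov's inequality with multiplicative weights: a point of \<open>a\<close> weighs
  \<open>s ^ 3\<close>, so a third of the indices in \<open>a\<close> gives weight at least
  \<open>s ^ r\<close>, whereas the mean weight per index is at most 2.\<close>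

lemma card_functions_hitting_le:
  fixes s :: nat
  assumes U: "finite U" and a: "a \<subseteq> U" and small: "card a * s ^ 3 \<le> card U"
  shows "card {f \<in> {..<r} \<rightarrow>\<^sub>E U. r \<le> 3 * card {i \<in> {..<r}. f i \<in> a}} * s ^ r \<le> (2 * card U) ^ r"
proof (cases "s = 0")
  case True
  then show ?thesis
    using U by (cases r) auto
next
  case False
  define H where "H = {f \<in> {..<r} \<rightarrow>\<^sub>E U. r \<le> 3 * card {i \<in> {..<r}. f i \<in> a}}"
  have fin: "finite ({..<r} \<rightarrow>\<^sub>E U)" using U by (intro finite_PiE) auto
  define w where "w u = (if u \<in> a then s ^ 3 else 1)" for u
  have "card H * s ^ r = (\<Sum>f\<in>H. s ^ r)" by simp
  also have "\<dots> \<le> (\<Sum>f\<in>H. \<Prod>i<r. w (f i))"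
  proof (intro sum_mono)
    fix f assume "f \<in> H"
    then have "s ^ r \<le> s ^ (3 * card {i \<in> {..<r}. f i \<in> a})"
      using False by (intro power_increasing) (auto simp: H_def)
    also have "\<dots> = (\<Prod>i\<in>{i \<in> {..<r}. f i \<in> a}. w (f i))"
      by (simp add: w_def power_mult)
    also have "\<dots> = (\<Prod>i<r. w (f i))"
      by (intro prod.mono_neutral_left) (auto simp: w_def)
    finally show "s ^ r \<le> (\<Prod>i<r. w (f i))" .
  qed
  also have "\<dots> \<le> (\<Sum>f\<in>{..<r} \<rightarrow>\<^sub>E U. \<Prod>i<r. w (f i))"
    using fin by (intro sum_mono2) (auto simp: H_def)
  also have "\<dots> = (\<Prod>i<r. \<Sum>u\<in>U. w u)"
    using U by (subst prod_sum_PiE) auto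
  also have "\<dots> = (\<Sum>u\<in>U. w u) ^ r" by simp
  also have "\<dots> \<le> (2 * card U) ^ r"
  proof (intro power_mono)
    have "(\<Sum>u\<in>U. w u) \<le> (\<Sum>u\<in>U. 1 + (if u \<in> a then s ^ 3 else 0))"
      by (intro sum_mono) (auto simp: w_def)
    also have "\<dots> = card U + (\<Sum>u\<in>U. if u \<in> a then s ^ 3 else 0)"
      by (simp only: sum.distrib) simp
    also have "(\<Sum>u\<in>U. if u \<in> a then s ^ 3 else 0) = (\<Sum>u\<in>a. s ^ 3)"
      using U a by (intro sum.mono_neutral_cong_right) auto
    finally show "(\<Sum>u\<in>U. w u) \<le> 2 * card U" using small by simp
  qed simp
  finally show ?thesis by (simp add: H_def)
qed

section \<open>Feasible trees on a sample located at one point\<close>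

text \<open>No split divides such a sample, so it arrives undivided at the leaf of \<open>x\<close>,
  where the majority condition fixes the answer.\<close>

lemma reached_leaf_of_single_point:
  assumes "\<And>e. e \<in># S \<Longrightarrow> fst e = x"
  shows "\<exists>m'. (m', S, Leaf (classify T x)) \<in> vertices m S T"
proof (induction T arbitrary: m)
  case (Node j t l r)
  show ?case
  proof (cases "x j \<le> t")
    case True
    then have "le_part S j t = S"
      using assms by (auto simp: le_part_def filter_mset_eq_conv)
    then show ?thesis using Node(1)[of "Suc m"] True by auto
  next
    case False
    then have "gt_part S j t = S"
      using assms by (auto simp: gt_part_def filter_mset_eq_conv)
    then show ?thesis using Node(2)[of "Suc m"] False by auto
  qed
qed auto

lemma feasible_classify_single_point:
  assumes "feasible d k h \<alpha> \<beta> S T" "\<And>e. e \<in># S \<Longrightarrow> fst e = x"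
  shows "majority_label S (classify T x)"
  using reached_leaf_of_single_point[OF assms(2), where T = T and m = 0] assms(1)
  unfolding feasible_def by fastforce

section \<open>Request sequences and their active multisets\<close>

definition double_ins :: "point list \<Rightarrow> request list" where
  "double_ins xs = concat (map (\<lambda>x. [Ins x True, Ins x True]) xs)"

definition double_del :: "point list \<Rightarrow> request list" where
  "double_del xs = concat (map (\<lambda>x. [Del x True, Del x True]) xs)"

lemma fold_perform_double_ins:
  "distinct xs \<Longrightarrow> count (fold perform (double_ins xs) S) e =
     count S e + (if snd e \<and> fst e \<in> set xs then 2 else 0)"
  by (cases e, induction xs arbitrary: S) (auto simp: double_ins_def)

text \<open>Two deletions erase every copy because no multiplicity exceeds 2; on points already
  absent they change nothing.\<close>

lemma fold_perform_double_del:
  assumes "\<And>e. count S e \<le> 2"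
  shows "count (fold perform (double_del xs) S) e =
     (if snd e \<and> fst e \<in> set xs then 0 else count S e)"
  using assms
proof (induction xs arbitrary: S)
  case (Cons x xs)
  define S' where "S' = S - {#(x, True), (x, True)#}"
  have S': "count S' e' = (if snd e' \<and> fst e' = x then 0 else count S e')" for e'
    using Cons.prems[of e'] unfolding S'_def by (cases e') auto
  have "count (fold perform (double_del xs) S') e =
      (if snd e \<and> fst e \<in> set xs then 0 else count S' e)"
    using Cons.prems by (intro Cons.IH) (simp add: S')
  then show ?case
    by (auto simp: double_del_def S' simp flip: S'_def)
qed (auto simp: double_del_def)

lemma active_double_ins_del:
  assumes "distinct xs"
  shows "active (double_ins xs @ double_del ys @ double_del zs @ [Ins u False]) =
     add_mset (u, False) (\<Sum>x\<in>set xs - set ys - set zs. {#(x, True), (x, True)#})"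
proof (rule multiset_eqI)
  fix e
  define S where "S = fold perform (double_ins xs) {#}"
  have S: "count S e = (if snd e \<and> fst e \<in> set xs then 2 else 0)" for e
    unfolding S_def using fold_perform_double_ins[OF assms] by simp
  define S' where "S' = fold perform (double_del ys) S"
  have S': "count S' e = (if snd e \<and> fst e \<in> set ys then 0 else count S e)" for e
    unfolding S'_def by (rule fold_perform_double_del) (simp add: S)
  have S'': "count (fold perform (double_del zs) S') e =
      (if snd e \<and> fst e \<in> set zs then 0 else count S' e)" for e
    by (rule fold_perform_double_del) (simp add: S S')
  have "count (active (double_ins xs @ double_del ys @ double_del zs @ [Ins u False])) e =
      count (add_mset (u, False) (fold perform (double_del zs) S')) e"
    by (simp add: active_def S_def S'_def)
  also have "\<dots> = count (add_mset (u, False)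
      (\<Sum>x\<in>set xs - set ys - set zs. {#(x, True), (x, True)#})) e"
  proof -
    have "(\<Sum>x\<in>B. count {#(x, True), (x, True)#} e) = (if snd e \<and> fst e \<in> B then 2 else 0)"
      if "finite B" for B :: "point set"
    proof -
      have "(\<Sum>x\<in>B. count {#(x, True), (x, True)#} e) =
          (\<Sum>x\<in>B. if x = fst e then if snd e then 2 else 0 else 0)"
        by (intro sum.cong refl) (cases e, auto)
      then show ?thesis using that by (simp add: sum.delta)
    qed
    then show ?thesis
      by (simp add: S'' S' S count_sum)
  qed
  finally show "count (active (double_ins xs @ double_del ys @ double_del zs @ [Ins u False])) e =
      count (add_mset (u, False) (\<Sum>x\<in>set xs - set ys - set zs. {#(x, True), (x, True)#})) e" .
qed

section \<open>Memory states and transitions\<close>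

text \<open>The transition kernel from a fixed memory state, which allows one state to be continued
  by many different deletion sequences.\<close>

definition exec :: "algorithm \<Rightarrow> request list \<Rightarrow> memory \<Rightarrow> memory pmf" where
  "exec A rs m = fold (\<lambda>r M. bind_pmf M (next_mem A r)) rs (return_pmf m)"

lemma fold_bind_next_mem:
  "fold (\<lambda>r M. bind_pmf M (next_mem A r)) rs (bind_pmf M f) =
     bind_pmf M (\<lambda>m. fold (\<lambda>r M. bind_pmf M (next_mem A r)) rs (f m))"
  by (induction rs arbitrary: f) (simp_all add: bind_assoc_pmf)

lemma run_append: "run A (rs @ rs') = bind_pmf (run A rs) (exec A rs')"
  using fold_bind_next_mem[of A rs' "run A rs" return_pmf]
  by (simp add: run_def exec_def[abs_def] bind_return_pmf')

lemma exec_append: "exec A (rs @ rs') m = bind_pmf (exec A rs m) (exec A rs')"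
  using fold_bind_next_mem[of A rs' "exec A rs m" return_pmf]
  by (simp add: exec_def[abs_def] bind_return_pmf')

lemma pmf_bind_sum:
  assumes "finite Q" "set_pmf M \<subseteq> Q"
  shows "pmf (bind_pmf M f) y = (\<Sum>q\<in>Q. pmf M q * pmf (f q) y)"
  unfolding pmf_bind using assms
  by (subst integral_measure_pmf[of Q]) (auto simp: mult.commute)

definition size_bounded :: "point set \<Rightarrow> nat \<Rightarrow> request list \<Rightarrow> bool" where
  "size_bounded X n rs \<longleftrightarrow> requests_over X rs \<and> (\<forall>i \<le> length rs. size (active (take i rs)) \<le> n)"

text \<open>The state space of the coding argument: at most \<open>2 ^ b\<close> states, closed
  under deleting points of \<open>X\<close>, since deletions cannot enlarge the active
  multiset.\<close>

definition reachable :: "algorithm \<Rightarrow> point set \<Rightarrow> nat \<Rightarrow> memory set" where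
  "reachable A X n = (\<Union>rs \<in> Collect (size_bounded X n). set_pmf (run A rs))"

lemma finite_reachable:
  assumes "space_at_most A X n b"
  shows "finite (reachable A X n)" "card (reachable A X n) \<le> 2 ^ b"
proof -
  have sub: "reachable A X n \<subseteq> (\<lambda>B i. i \<in> B) ` Pow {..<b}"
  proof
    fix m assume "m \<in> reachable A X n"
    then have "\<forall>i\<ge>b. \<not> m i"
      using assms by (fastforce simp: reachable_def size_bounded_def space_at_most_def)
    then have "{i. m i} \<in> Pow {..<b}" by (auto simp: not_le[symmetric])
    moreover have "m = (\<lambda>i. i \<in> {i. m i})" by simp
    ultimately show "m \<in> (\<lambda>B i. i \<in> B) ` Pow {..<b}" by blast
  qed
  then show "finite (reachable A X n)" by (rule finite_subset) simp
  have "card (reachable A X n) \<le> card ((\<lambda>B i. i \<in> B) ` Pow {..<b})"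
    using sub by (intro card_mono) auto
  also have "\<dots> \<le> card (Pow {..<b})" by (intro card_image_le) simp
  finally show "card (reachable A X n) \<le> 2 ^ b" by (simp add: card_Pow)
qed

lemma size_bounded_append_del:
  assumes "size_bounded X n rs" "set ys \<subseteq> X"
  shows "size_bounded X n (rs @ double_del ys)"
proof -
  have *: "size (fold perform rs' S) \<le> size S"
    if "set rs' \<subseteq> range (\<lambda>x. Del x True)" for rs' S
    using that
  proof (induction rs' arbitrary: S)
    case (Cons r rs')
    then obtain x where "r = Del x True" by auto
    then have "size (perform r S) \<le> size S" by (simp add: size_Diff_subset_Int size_mset_mono)
    with Cons show ?case by (auto intro: order.trans)
  qed simp
  have "size (active (take i (rs @ double_del ys))) \<le> n" for i
  proof (cases "i \<le> length rs")
    case True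
    then show ?thesis using assms(1) by (simp add: size_bounded_def)
  next
    case False
    have "size (active (take i (rs @ double_del ys))) \<le> size (active rs)"
      using False unfolding active_def
      by (simp, intro *, intro order.trans[OF set_take_subset]) (auto simp: double_del_def)
    then show ?thesis using assms(1) by (auto simp: size_bounded_def dest: spec[of _ "length rs"])
  qed
  then show ?thesis
    using assms by (auto simp: size_bounded_def requests_over_def double_del_def)
qed

lemma size_bounded_double_ins:
  assumes "2 * length xs \<le> n" "set xs \<subseteq> X"
  shows "size_bounded X n (double_ins xs)"
proof -
  have *: "size (fold perform rs S) \<le> size S + length rs" for rs S
  proof (induction rs arbitrary: S)
    case (Cons r rs)
    have "size (perform r S) \<le> Suc (size S)"
      by (cases r) (auto simp: size_Diff_subset_Int intro: le_SucI size_mset_mono)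
    with Cons[of "perform r S"] show ?case by simp
  qed simp
  have "length (double_ins xs) = 2 * length xs"
    by (induction xs) (auto simp: double_ins_def)
  then have "size (active (take i (double_ins xs))) \<le> n" for i
    using *[of "take i (double_ins xs)" "{#}"] assms(1) by (simp add: active_def)
  then show ?thesis
    using assms by (auto simp: size_bounded_def requests_over_def double_ins_def)
qed

lemma set_pmf_exec_reachable:
  assumes "m \<in> reachable A X n" "set ys \<subseteq> X"
  shows "set_pmf (exec A (double_del ys) m) \<subseteq> reachable A X n"
proof -
  obtain rs where rs: "size_bounded X n rs" "m \<in> set_pmf (run A rs)"
    using assms(1) by (auto simp: reachable_def)
  then have "set_pmf (exec A (double_del ys) m) \<subseteq> set_pmf (run A (rs @ double_del ys))"
    by (auto simp: run_append)
  then show ?thesis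
    using size_bounded_append_del[OF rs(1) assms(2)] by (auto simp: reachable_def)
qed

section \<open>Membership tests and short lists\<close>

text \<open>
  Deletions of inactive examples have no effect, so deleting first \<open>ys\<close> and then everything except
  \<open>u\<close> tests membership of \<open>u\<close> in \<open>xs - ys\<close>, although \<open>zs\<close> does not depend on \<open>xs\<close>. The copies are
  doubled so that the majority label at \<open>u\<close> is determined in both cases.
\<close>

lemma membership_test:
  assumes A: "weakly_feasible d X k h \<alpha> \<beta> (3 / 4) A"
    and xs: "distinct xs" "u \<in> set xs" "u \<notin> set zs" "set xs \<subseteq> insert u (set zs)"
    and X: "set xs \<subseteq> X" "set ys \<subseteq> X" "set zs \<subseteq> X"
  defines "pr \<equiv> pmf (answer A (double_ins xs @ double_del ys @ double_del zs @ [Ins u False]) u) True"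
  shows "if u \<in> set ys then pr \<le> 1 / 4 else pr \<ge> 3 / 4"
proof -
  define rs where "rs = double_ins xs @ double_del ys @ double_del zs @ [Ins u False]"
  have "requests_over X rs"
    using xs X by (auto simp: rs_def requests_over_def double_ins_def double_del_def)
  then obtain T where T: "feasible d k h \<alpha> \<beta> (active rs) T"
      "3 / 4 \<le> measure_pmf.prob (answer A rs u) {classify T u}"
    using A xs X unfolding weakly_feasible_def by blast
  have active: "active rs = add_mset (u, False)
      (if u \<in> set ys then {#} else {#(u, True), (u, True)#})"
  proof -
    have "set xs - set ys - set zs = (if u \<in> set ys then {} else {u})"
      using xs by auto
    then show ?thesis
      unfolding rs_def by (subst active_double_ins_del[OF xs(1)]) simp
  qed
  have "majority_label (active rs) (classify T u)"
    by (rule feasible_classify_single_point[OF T(1)]) (auto simp: active split: if_splits)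
  then have "classify T u \<longleftrightarrow> u \<notin> set ys"
    by (cases "classify T u") (auto simp: majority_label_def active split: if_splits)
  then show ?thesis
    using T(2) unfolding pr_def rs_def[symmetric]
    by (auto simp: measure_pmf_single pmf_False_conv_True)
qed

text \<open>
  Each memory state \<open>q\<close> yields the list \<open>L q\<close> of those points whose later deletion would be
  noticed by an algorithm in state \<open>q\<close>. The list is short because the algorithm has to store the
  deletions, and it contains each inserted point with probability at least 1/3.
\<close>

lemma covering_family:
  assumes A: "weakly_feasible d X k h \<alpha> \<beta> (3 / 4) A" "space_at_most A X n b"
    and U: "finite U" "U \<subseteq> X" and r: "2 * r \<le> n"
  obtains \<A> where "finite \<A>" "card \<A> \<le> 2 ^ b"
    "\<And>a. a \<in> \<A> \<Longrightarrow> a \<subseteq> U \<and> card a \<le> 64 * b"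
    "\<And>f. f \<in> {..<r} \<rightarrow> U \<Longrightarrow> \<exists>a\<in>\<A>. r \<le> 3 * card {i \<in> {..<r}. f i \<in> a}"
proof -
  define Q where "Q = reachable A X n"
  have Q: "finite Q" "card Q \<le> 2 ^ b"
    using finite_reachable[OF A(2)] by (simp_all add: Q_def)
  define listing :: "point set \<Rightarrow> point list" where
    "listing D = (SOME xs. set xs = D \<and> distinct xs)" for D
  have listing: "set (listing D) = D" "distinct (listing D)" if "D \<subseteq> U" for D
    using someI_ex[OF finite_distinct_list[OF finite_subset[OF that U(1)]]]
    by (simp_all add: listing_def)
  define p where "p q D q' = pmf (exec A (double_del (listing D)) q) q'" for q D q'
  \<comment> \<open>Answer \<open>True\<close> means that \<open>u\<close> has survived. The
    requests depend only on \<open>u\<close> and \<open>U\<close>, so this is a function of the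
    memory state alone.\<close>
  define t where
    "t u q = pmf (bind_pmf (exec A (double_del (listing (U - {u})) @ [Ins u False]) q)
       (\<lambda>m. map_pmf fst (on_lab A u m))) True" for u q
  have p_nonneg: "0 \<le> p q D q'" for q D q'
    by (simp add: p_def)
  have p_sum: "(\<Sum>q'\<in>Q. p q D q') = 1" if "q \<in> Q" "D \<subseteq> U" for q D
    unfolding p_def using that Q listing(1)[of D] U
    by (intro sum_pmf_eq_1 set_pmf_exec_reachable[of q A X n, folded Q_def]) auto
  have t: "0 \<le> t u q \<and> t u q \<le> 1" for u q
    by (simp add: t_def pmf_le_1)
  define L where "L q = {u \<in> U. 1 / 4 \<le> correlation U Q (p q) (t u) u}" for q
  have card_L: "card (L q) \<le> 64 * b" if q: "q \<in> Q" for q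
  proof -
    have "real (card (L q)) \<le> 64 * ln (card Q)"
      using q U(1) Q p_nonneg p_sum t
      by (intro card_correlated_le[where U = U and p = "p q" and t = t]) (auto simp: L_def)
    also have "ln (real (card Q)) \<le> ln (real (2 ^ b))"
    proof (rule ln_mono)
      show "0 < real (card Q)" using Q(1) q by (auto simp: card_gt_0_iff)
      show "real (card Q) \<le> real (2 ^ b)" using Q(2) by (rule of_nat_mono)
    qed
    also have "ln (real (2 ^ b)) = b * ln 2"
      by (simp add: ln_realpow)
    also have "\<dots> \<le> real b * 1"
      using ln_le_minus_one[of "2 :: real"] by (intro mult_left_mono) auto
    finally show ?thesis by simp
  qed
  have hit: "\<exists>q\<in>Q. r \<le> 3 * card {i \<in> {..<r}. f i \<in> L q}" if f: "f \<in> {..<r} \<rightarrow> U" for f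
  \<comment> \<open>Averaging: each index lands in the list of a random state with probability at
    least 1/3, so the expected number of hits is at least \<open>r / 3\<close> and some state
    attains it.\<close>
  proof (rule ccontr)
    assume none: "\<not> ?thesis"
    \<comment> \<open>\<open>f\<close> may repeat values: each point is inserted once, but hits are
      counted by index.\<close>
    define xs where "xs = listing (f ` {..<r})"
    have xs: "set xs = f ` {..<r}" "distinct xs"
      using listing[of "f ` {..<r}"] f by (auto simp: xs_def)
    have len: "2 * length xs \<le> n"
      using card_image_le[of "{..<r}" f] r by (simp flip: distinct_card[OF xs(2)] add: xs(1))
    have X: "set xs \<subseteq> X" using xs f U by auto
    define M where "M = run A (double_ins xs)"
    have M: "set_pmf M \<subseteq> Q"
      using size_bounded_double_ins[OF len X] by (auto simp: M_def Q_def reachable_def)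
    have each: "1 / 3 \<le> (\<Sum>q\<in>Q. pmf M q * of_bool (f i \<in> L q))" if i: "i < r" for i
    proof -
      define u where "u = f i"
      have u: "u \<in> U" "u \<in> set xs" using f i xs by (auto simp: u_def)
      have "1 / 3 \<le> (\<Sum>q\<in>Q. pmf M q * of_bool (1 / 4 \<le> correlation U Q (p q) (t u) u))"
      proof (rule prob_correlated_ge[OF U(1) Q(1), where \<mu> = "pmf M" and p = p and t = "t u" and u = u])
        show "(\<Sum>q\<in>Q. pmf M q) = 1"
          using M Q by (intro sum_pmf_eq_1) auto
        fix D assume D: "D \<subseteq> U"
        \<comment> \<open>Cutting the run after the insertions and again after deleting
          \<open>D\<close> turns the answer probability into a double sum over memory
          states.\<close>
        have "pmf (answer A (double_ins xs @ double_del (listing D)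
              @ double_del (listing (U - {u})) @ [Ins u False]) u) True =
            pmf (bind_pmf M (\<lambda>q. bind_pmf (exec A (double_del (listing D)) q) (\<lambda>q'.
              bind_pmf (exec A (double_del (listing (U - {u})) @ [Ins u False]) q')
                (\<lambda>m. map_pmf fst (on_lab A u m))))) True"
          by (simp add: answer_def M_def run_append exec_append bind_assoc_pmf)
        also have "\<dots> = (\<Sum>q\<in>Q. pmf M q * (\<Sum>q'\<in>Q. p q D q' * t u q'))"
          unfolding pmf_bind_sum[OF Q(1) M] p_def t_def
        proof (intro sum.cong refl arg_cong[where f = "(*) _"] pmf_bind_sum Q(1))
          fix q assume "q \<in> Q"
          then show "set_pmf (exec A (double_del (listing D)) q) \<subseteq> Q"
            using D U listing(1)[of D] unfolding Q_def
            by (intro set_pmf_exec_reachable) auto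
        qed
        finally have eq: "pmf (answer A (double_ins xs @ double_del (listing D)
              @ double_del (listing (U - {u})) @ [Ins u False]) u) True =
            (\<Sum>q\<in>Q. pmf M q * (\<Sum>q'\<in>Q. p q D q' * t u q'))" .
        have rest: "set (listing (U - {u})) = U - {u}" by (intro listing) auto
        have "set xs \<subseteq> insert u (set (listing (U - {u})))"
          using f xs(1) rest by auto
        moreover have "u \<notin> set (listing (U - {u}))" using rest by simp
        moreover have "set (listing D) \<subseteq> X" "set (listing (U - {u})) \<subseteq> X"
          using rest listing(1)[OF D] D U(2) by auto
        ultimately show "if u \<in> D
            then (\<Sum>q\<in>Q. pmf M q * (\<Sum>q'\<in>Q. p q D q' * t u q')) \<le> 1 / 4
            else 3 / 4 \<le> (\<Sum>q\<in>Q. pmf M q * (\<Sum>q'\<in>Q. p q D q' * t u q'))"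
          using membership_test[OF A(1) xs(2) u(2), of "listing (U - {u})" "listing D"] X
          unfolding eq listing(1)[OF D] by blast
      qed (use p_nonneg p_sum t in auto)
      then show ?thesis using u by (simp add: L_def u_def)
    qed
    have "r / 3 = (\<Sum>i<r. 1 / 3)" by simp
    also have "\<dots> \<le> (\<Sum>i<r. \<Sum>q\<in>Q. pmf M q * of_bool (f i \<in> L q))"
      using each by (intro sum_mono) auto
    also have "\<dots> = (\<Sum>q\<in>Q. \<Sum>i<r. pmf M q * of_bool (f i \<in> L q))"
      by (rule sum.swap)
    also have "\<dots> = (\<Sum>q\<in>Q. pmf M q * card {i \<in> {..<r}. f i \<in> L q})"
      by (simp add: sum_of_bool_eq Int_def flip: sum_distrib_left)
    also have "\<dots> < (\<Sum>q\<in>Q. pmf M q * (r / 3))"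
    proof -
      \<comment> \<open>Strictness needs a state of positive mass, hence one from the support of
        \<open>M\<close>.\<close>
      obtain q where q: "q \<in> set_pmf M" using set_pmf_not_empty[of M] by auto
      have *: "real (card {i \<in> {..<r}. f i \<in> L q}) < r / 3" if "q \<in> Q" for q
        using none that by (auto simp: not_le)
      show ?thesis
      proof (rule sum_strict_mono_ex1[OF Q(1)])
        show "\<forall>q\<in>Q. pmf M q * card {i \<in> {..<r}. f i \<in> L q} \<le> pmf M q * (r / 3)"
          using * by (intro ballI mult_left_mono) (auto intro: less_imp_le)
        have "pmf M q * card {i \<in> {..<r}. f i \<in> L q} < pmf M q * (r / 3)"
          using q M by (intro mult_strict_left_mono * pmf_positive) auto
        then show "\<exists>q\<in>Q. pmf M q * card {i \<in> {..<r}. f i \<in> L q} < pmf M q * (r / 3)"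
          using q M by blast
      qed
    qed
    also have "\<dots> = r / 3"
      unfolding sum_distrib_right[symmetric] using M Q(1) by (simp add: sum_pmf_eq_1)
    finally show False by simp
  qed
  show thesis
  proof (rule that[of "L ` Q"])
    show "finite (L ` Q)" using Q(1) by simp
    show "card (L ` Q) \<le> 2 ^ b" using card_image_le[OF Q(1), of L] Q(2) by simp
    show "a \<subseteq> U \<and> card a \<le> 64 * b" if "a \<in> L ` Q" for a
      using that card_L by (auto simp: L_def)
    show "\<exists>a\<in>L ` Q. r \<le> 3 * card {i \<in> {..<r}. f i \<in> a}" if "f \<in> {..<r} \<rightarrow> U" for f
      using hit[OF that] by blast
  qed
qed

section \<open>Space bounds from the short lists\<close>

text \<open>For an injective \<open>f\<close> the hits are distinct points, so a single list of at
  most \<open>64 * b\<close> points contains at least \<open>r / 3\<close> of them.\<close>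

lemma number_of_examples_le:
  assumes "weakly_feasible d X k h \<alpha> \<beta> (3 / 4) A" "space_at_most A X n b"
    and U: "finite U" "U \<subseteq> X" and r: "2 * r \<le> n" "r \<le> card U"
  shows "r \<le> 192 * b"
proof -
  obtain \<A> where "finite \<A>" "card \<A> \<le> 2 ^ b"
    and \<A>: "\<And>a. a \<in> \<A> \<Longrightarrow> a \<subseteq> U \<and> card a \<le> 64 * b"
    "\<And>f. f \<in> {..<r} \<rightarrow> U \<Longrightarrow> \<exists>a\<in>\<A>. r \<le> 3 * card {i \<in> {..<r}. f i \<in> a}"
    by (rule covering_family[OF assms(1-4) r(1)], rule that)
  obtain f where f: "f ` {..<r} \<subseteq> U" "inj_on f {..<r}"
    using card_le_inj[of "{..<r}" U] U r by auto
  then obtain a where a: "a \<in> \<A>" "r \<le> 3 * card {i \<in> {..<r}. f i \<in> a}"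
    using \<A>(2)[of f] by auto
  have "card {i \<in> {..<r}. f i \<in> a} \<le> card a"
    using \<A>(1)[OF a(1)] U f by (intro card_inj_on_le[of f]) (auto intro: inj_on_subset finite_subset)
  then show ?thesis using a \<A>(1)[OF a(1)] by simp
qed

text \<open>Union bound over the \<open>2 ^ b\<close> lists: with \<open>s = 2 ^ j\<close>, so
  \<open>s ^ 3 = 8 ^ j\<close>, each list serves at most a fraction \<open>(2 / 2 ^ j) ^ r\<close>
  of all functions, yet every function is served.\<close>

lemma log_number_of_samples_le:
  assumes "weakly_feasible d X k h \<alpha> \<beta> (3 / 4) A" "space_at_most A X n b"
    and U: "finite U" "U \<subseteq> X" and r: "2 * r \<le> n" and j: "64 * b * 8 ^ j \<le> card U" "U \<noteq> {}"
  shows "j * r \<le> r + b"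
proof -
  obtain \<A> where \<A>: "finite \<A>" "card \<A> \<le> 2 ^ b" "\<And>a. a \<in> \<A> \<Longrightarrow> a \<subseteq> U \<and> card a \<le> 64 * b"
    "\<And>f. f \<in> {..<r} \<rightarrow> U \<Longrightarrow> \<exists>a\<in>\<A>. r \<le> 3 * card {i \<in> {..<r}. f i \<in> a}"
    by (rule covering_family[OF assms(1-4) r], rule that)
  define H where "H a = {f \<in> {..<r} \<rightarrow>\<^sub>E U. r \<le> 3 * card {i \<in> {..<r}. f i \<in> a}}" for a
  have fin: "finite ({..<r} \<rightarrow>\<^sub>E U)" using U by (intro finite_PiE) auto
  have "{..<r} \<rightarrow>\<^sub>E U \<subseteq> (\<Union>a\<in>\<A>. H a)"
    using \<A>(4) by (fastforce simp: H_def PiE_def)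
  then have "card ({..<r} \<rightarrow>\<^sub>E U) \<le> card (\<Union>a\<in>\<A>. H a)"
    using \<A>(1) fin by (intro card_mono) (auto simp: H_def)
  also have "\<dots> \<le> (\<Sum>a\<in>\<A>. card (H a))"
    using \<A>(1) by (rule card_UN_le)
  finally have "card U ^ r * (2 ^ j) ^ r \<le> (\<Sum>a\<in>\<A>. card (H a)) * (2 ^ j) ^ r"
    by (simp add: card_PiE)
  also have "\<dots> = (\<Sum>a\<in>\<A>. card (H a) * (2 ^ j) ^ r)"
    by (rule sum_distrib_right)
  also have "\<dots> \<le> (\<Sum>a\<in>\<A>. (2 * card U) ^ r)"
    unfolding H_def
  proof (intro sum_mono card_functions_hitting_le U(1))
    fix a assume a: "a \<in> \<A>"
    then show "a \<subseteq> U" using \<A>(3) by blast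
    have "card a * (2 ^ j) ^ 3 \<le> 64 * b * 8 ^ j"
      using \<A>(3)[OF a] by (simp add: mult.commute[of j] flip: power_mult)
        (simp add: power_mult)
    then show "card a * (2 ^ j) ^ 3 \<le> card U" using j(1) by simp
  qed
  also have "\<dots> \<le> 2 ^ b * (2 * card U) ^ r"
    using \<A>(2) by simp
  finally have "card U ^ r * 2 ^ (j * r) \<le> card U ^ r * 2 ^ (r + b)"
    by (simp add: power_mult_distrib power_mult power_add mult_ac)
  then have "(2 :: nat) ^ (j * r) \<le> 2 ^ (r + b)"
    using U(1) j(2) by (simp add: card_gt_0_iff)
  then show ?thesis by simp
qed

section \<open>The lower bound on both domains\<close>

lemma infinite_real_domain:
  assumes "1 \<le> d"
  shows "infinite (real_domain d)"
proof
  assume "finite (real_domain d)"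
  moreover have "range (\<lambda>a. \<lambda>i\<in>{1..d}. a) \<subseteq> real_domain d"
    by (auto simp: real_domain_def)
  moreover have "inj (\<lambda>a::real. \<lambda>i\<in>{1..d}. a)"
    using assms by (auto simp: inj_def fun_eq_iff restrict_def split: if_splits)
  ultimately show False
    using infinite_UNIV_char_0[where 'a = real] by (metis finite_imageD finite_subset)
qed

theorem theorem4p1:
  "\<exists>c > 0. \<forall>(k::nat) (h::nat) (\<alpha>::real) (\<beta>::real) (d::nat) (n::nat) (X :: point set)
      (A :: algorithm) (b::nat).
     1 \<le> k \<longrightarrow> 1 \<le> h \<longrightarrow> 0 \<le> \<alpha> \<longrightarrow> \<alpha> \<le> 1 \<longrightarrow> 0 \<le> \<beta> \<longrightarrow> \<beta> < 1 / 24 \<longrightarrow>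
     1 \<le> d \<longrightarrow> 2 \<le> n \<longrightarrow>
     X = real_domain d \<or> (X = boolean_domain d \<and> n \<le> k * 2 ^ d) \<longrightarrow>
     weakly_feasible d X k h \<alpha> \<beta> (3 / 4) A \<longrightarrow>
     space_at_most A X n b \<longrightarrow>
     real b \<ge> c * ((real n * real d) / (real k * ln (real n)))"
\<comment> \<open>28800 = 3 * 192 * 50, from the case of small \<open>d\<close> on the Boolean
  domain.\<close>
proof (intro exI[of _ "1 / 28800"] conjI allI impI)
  fix k h d n b :: nat and \<alpha> \<beta> :: real and X :: "point set" and A :: algorithm
  assume k: "1 \<le> k" and d: "1 \<le> d" and n: "2 \<le> n"
    and X: "X = real_domain d \<or> (X = boolean_domain d \<and> n \<le> k * 2 ^ d)"
    and A: "weakly_feasible d X k h \<alpha> \<beta> (3 / 4) A" "space_at_most A X n b"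
  have half: "2 * (n div 2) \<le> n" by simp
  have "n \<le> 3 * (n div 2)" using n by linarith
  then have third: "real n / 3 \<le> real (n div 2)" by linarith
  have "ln 2 \<le> ln (real n)" using n by (intro ln_mono) auto
  moreover have ln2: "ln (2::real) > 1 / 2"
  proof -
    have "exp (1 / 2 :: real) \<le> 1 + 1 / 2 + (1 / 2)\<^sup>2" by (rule exp_bound) auto
    also have "\<dots> < 2" by (simp add: power2_eq_square)
    finally have "ln (exp (1 / 2 :: real)) < ln 2" by (subst ln_less_cancel_iff) auto
    then show ?thesis by simp
  qed
  ultimately have ln_n: "1 / 2 < ln (real n)" by simp
  have "real n * real d \<le> 28800 * real b * (k * ln (real n))"
  proof (cases "X = real_domain d")
    case True
    \<comment> \<open>With \<open>j = b + 2\<close> and \<open>r = 1\<close> the bound reads b + 2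
      \<le> 1 + b, so no finite \<open>b\<close> is possible. The extra point keeps \<open>U\<close>
      nonempty when \<open>b = 0\<close>.\<close>
    obtain U where U: "finite U" "U \<subseteq> X" "card U = 64 * b * 8 ^ (b + 2) + 1"
      using infinite_arbitrarily_large[OF infinite_real_domain[OF d]] True by metis
    then have "(b + 2) * 1 \<le> 1 + b"
      using n by (intro log_number_of_samples_le[OF A U(1,2), where r = 1]) auto
    then show ?thesis by simp
  next
    case False
    then have X: "X = boolean_domain d" "n \<le> k * 2 ^ d" using X by auto
    have finX: "finite X" and cardX: "card X = 2 ^ d"
      by (auto simp: X boolean_domain_def card_PiE numeral_2_eq_2 intro!: finite_PiE)
    show ?thesis
    \<comment> \<open>For small \<open>d\<close> the factor d / ln n is at most 50, so b =
      \<Omega>(n / k) is enough. For large \<open>d\<close> the threshold gives ln n \<le> d div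
      8.\<close>
    proof (cases "real d \<le> 50 * ln (real n)")
      case True
      define r where "r = min (n div 2) (2 ^ d)"
      have "r \<le> 192 * b"
        by (rule number_of_examples_le[OF A finX]) (auto simp: r_def cardX)
      then have "real r \<le> 192 * real b" by linarith
      then have "3 * k * real r \<le> 3 * k * (192 * real b)" by (intro mult_left_mono) auto
      moreover have "real n \<le> 3 * k * real r"
      proof (cases "n div 2 \<le> 2 ^ d")
        case True
        have "real n \<le> 3 * real r" using True third by (simp add: r_def)
        also have "\<dots> \<le> 3 * k * real r" using k by (simp add: mult_right_mono)
        finally show ?thesis .
      next
        case False
        \<comment> \<open>All \<open>2 ^ d\<close> points are in use here, and the factor
          \<open>k\<close> makes up for the rest of \<open>n\<close>.\<close>
        have "real n \<le> real (k * 2 ^ d)" using X(2) by (simp only: of_nat_le_iff)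
        also have "\<dots> \<le> 3 * k * real r" using False by (simp add: r_def)
        finally show ?thesis .
      qed
      ultimately have "real n \<le> 3 * k * (192 * real b)"
        by (rule order.trans[rotated])
      then have "real n * real d \<le> (3 * k * (192 * real b)) * (50 * ln (real n))"
        using True by (intro mult_mono) auto
      then show ?thesis by (simp add: mult_ac)
    next
      case large: False
      define j where "j = d div 8"
      have d25: "25 < real d" using large ln_n by linarith
      have j: "8 * j \<le> d" "real d \<le> 8 * j + 7" "2 \<le> j" "d \<le> 16 * j"
        using d25 unfolding j_def by linarith+
      have "real n * real d \<le> 960 * real b"
      \<comment> \<open>Either the cube is large enough for the union bound, or 32^j < 64 * b. In
        the latter case n \<le> 4^j and d \<le> 15 * 2^j give n * d \<le> 15 * 8^j, which is below
        15 * 64 * b = 960 * b.\<close>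
      proof (cases "64 * b * 8 ^ j \<le> 2 ^ d")
        case True
        have "X \<noteq> {}" using cardX by auto
        then have "j * (n div 2) \<le> n div 2 + b"
          using True by (intro log_number_of_samples_le[OF A finX subset_refl half])
            (auto simp: cardX)
        then have "(real j - 1) * real (n div 2) \<le> real b"
          by (simp add: algebra_simps flip: of_nat_mult of_nat_add)
        \<comment> \<open>The subtracted 1 is absorbed by j \<ge> 2, as 8 * j + 7 \<le> 32 * (j -
          1).\<close>
        moreover have "(real d / 32) * (real n / 3) \<le> (real j - 1) * real (n div 2)"
          using j third by (intro mult_mono) linarith+
        ultimately have "(real d / 32) * (real n / 3) \<le> real b"
          by (rule order.trans[rotated])
        then have "real n * real d \<le> 96 * real b" by (simp add: mult.commute)
        then show ?thesis by simp
      next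
        case False
        have "(2::nat) ^ (5 * j) * 8 ^ j = 2 ^ (8 * j)"
          by (simp add: power_mult flip: power_mult_distrib)
        also have "\<dots> \<le> 2 ^ d" using j by (intro power_increasing) auto
        also have "\<dots> < 64 * b * 8 ^ j" using False by simp
        finally have "2 ^ (5 * j) < 64 * b" by simp
        then have "32 ^ j \<le> 64 * b" by (simp add: power_mult)
        then have b: "(32::real) ^ j \<le> 64 * real b"
          by (metis of_nat_mono of_nat_mult of_nat_numeral of_nat_power)
        have "ln (real n) \<le> real j" using large j by linarith
        then have "exp (ln (real n)) \<le> exp (real j)" by simp
        then have "real n \<le> exp (real j)" using n by simp
        also have "\<dots> = exp 1 ^ j" by (simp add: exp_of_nat_mult[symmetric])
        also have "\<dots> \<le> 4 ^ j" using exp_le by (intro power_mono) auto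
        finally have 1: "real n \<le> 4 ^ j" .
        have "j \<le> 2 ^ j" by (simp add: less_imp_le)
        then have "d \<le> 15 * 2 ^ j" using j by linarith
        then have "real d \<le> 15 * 2 ^ j" by (metis of_nat_mono of_nat_mult of_nat_numeral of_nat_power)
        with 1 have "real n * real d \<le> 4 ^ j * (15 * 2 ^ j)" by (intro mult_mono) auto
        also have "\<dots> = 15 * 8 ^ j" by (simp flip: power_mult_distrib)
        also have "\<dots> \<le> 15 * 32 ^ j" by (simp add: power_mono)
        finally show ?thesis using b by simp
      qed
      also have "\<dots> \<le> 28800 * real b * (1 * (1 / 2))" by simp
      also have "\<dots> \<le> 28800 * real b * (k * ln (real n))"
        using k ln_n by (intro mult_left_mono mult_mono) auto
      finally show ?thesis .
    qed
  qed
  then show "1 / 28800 * (real n * real d / (real k * ln (real n))) \<le> real b"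
    using k ln_n by (simp add: divide_simps mult_ac)
qed simp

end
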